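(* Let $A\in\mathbb{R}^{d\times d}$ be symmetric with eigenvalues $\mu_1,\dots,\mu_d$, let $R=\operatorname{sign}(A)$, and let $\widetilde R=\phi(A)$ for a scalar (real-valued) function $\phi$ defined on the spectrum of $A$. Then $$\|\widetilde R-R\|_2=\max_{1\le i\le d}\bigl|\phi(\mu_i)-\operatorname{sign}(\mu_i)\bigr|.$$
   Context: For a scalar function $f$ defined on the spectrum of a symmetric matrix $A=Q\operatorname{diag}(\mu_i)Q^T$ ($Q$ orthogonal), $f(A)=Q\operatorname{diag}(f(\mu_i))Q^T$; $\operatorname{sign}(A)$ is obtained with $f$ the scalar sign function (convention $\operatorname{sign}(0)=0$). $\|\cdot\|_2$ is the spectral norm. *)

theory Defs
  imports "HOL-Analysis.Analysis"
begin

definition diag_mat :: "('d \<Rightarrow> real) \<Rightarrow> real^'d^'d" where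
  "diag_mat m = (\<chi> i j. if i = j then m i else 0)"

text \<open>
  The family \<open>m\<close> lists the eigenvalues of \<open>A\<close> with algebraic multiplicity: the characteristic
  polynomial of \<open>A\<close> is the product of the linear factors \<open>x - m i\<close>. Here \<open>mat x\<close> is \<open>x\<close> times
  the identity matrix, and equality at every real \<open>x\<close> is equality of polynomials.
\<close>
definition eigenvalues_listed_by :: "real^'d^'d \<Rightarrow> ('d \<Rightarrow> real) \<Rightarrow> bool" where
  "eigenvalues_listed_by A m \<longleftrightarrow> (\<forall>x. det (mat x - A) = (\<Prod>i\<in>UNIV. x - m i))"

text \<open>
  Only the values of \<open>f\<close> on the spectrum of \<open>A\<close> enter. The description is unambiguous for symmetric
  \<open>A\<close>: by \<open>matrix_fun_eq\<close> below, any orthogonal diagonalisation of \<open>A\<close> gives the same matrix.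
\<close>
definition matrix_fun :: "(real \<Rightarrow> real) \<Rightarrow> real^'d^'d \<Rightarrow> real^'d^'d" where
  "matrix_fun f A = (THE B. \<exists>Q m. orthogonal_matrix Q \<and> A = Q ** diag_mat m ** transpose Q \<and>
                                  B = Q ** diag_mat (\<lambda>i. f (m i)) ** transpose Q)"

lemma matrix_mult_diag_mat: "(W ** diag_mat m) $ i $ j = W $ i $ j * m j"
  by (simp add: matrix_matrix_mult_def diag_mat_def if_distrib cong: if_cong)

lemma diag_mat_mult_matrix: "(diag_mat m ** W) $ i $ j = m i * W $ i $ j"
  by (simp add: matrix_matrix_mult_def diag_mat_def if_distrib[where f="\<lambda>x. x * _"] cong: if_cong)

lemma matrix_fun_unique:
  fixes P Q :: "real^'d^'d"
  assumes P: "orthogonal_matrix P" and Q: "orthogonal_matrix Q"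
    and eq: "Q ** diag_mat m ** transpose Q = P ** diag_mat n ** transpose P"
  shows "Q ** diag_mat (\<lambda>i. f (m i)) ** transpose Q = P ** diag_mat (\<lambda>i. f (n i)) ** transpose P"
proof -
  define W where "W = transpose P ** Q"
  have PP: "transpose P ** P = mat 1" "P ** transpose P = mat 1"
    and QQ: "transpose Q ** Q = mat 1" "Q ** transpose Q = mat 1"
    using P Q by (auto simp: orthogonal_matrix_def)
  have "W ** diag_mat m = transpose P ** (Q ** diag_mat m ** transpose Q) ** Q"
    by (metis W_def QQ(1) matrix_mul_assoc matrix_mul_rid)
  also have "\<dots> = diag_mat n ** W"
    unfolding eq W_def by (metis PP(1) matrix_mul_assoc matrix_mul_lid)
  finally have "W $ i $ j * m j = n i * W $ i $ j" for i j
    by (metis matrix_mult_diag_mat diag_mat_mult_matrix)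
  hence "W $ i $ j * f (m j) = f (n i) * W $ i $ j" for i j
    by (cases "W $ i $ j = 0") (metis mult_zero_left mult_zero_right, metis mult.commute mult_left_cancel)
  hence comm: "W ** diag_mat (\<lambda>i. f (m i)) = diag_mat (\<lambda>i. f (n i)) ** W"
    by (simp add: vec_eq_iff matrix_mult_diag_mat diag_mat_mult_matrix)
  have "Q = P ** W"
    by (metis W_def PP(2) matrix_mul_assoc matrix_mul_lid)
  moreover have "W ** transpose Q = transpose P"
    by (metis W_def QQ(2) matrix_mul_assoc matrix_mul_rid)
  ultimately show ?thesis
    using comm by (metis matrix_mul_assoc)
qed

lemma matrix_fun_eq:
  assumes "orthogonal_matrix Q" "A = Q ** diag_mat m ** transpose Q"
  shows "matrix_fun f A = Q ** diag_mat (\<lambda>i. f (m i)) ** transpose Q"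
  unfolding matrix_fun_def
  using assms by (intro the_equality) (auto intro: matrix_fun_unique)

end

theory Submission
  imports Defs
begin

text \<open>
  In an orthonormal eigenbasis of \<open>A\<close>, every function of \<open>A\<close> is diagonal. Thus \<open>\<phi>(A) - sign(A)\<close> is
  \<open>Q diag(\<phi>(m\<^sub>i) - sign(m\<^sub>i)) Q\<^sup>T\<close> for one orthogonal \<open>Q\<close>, and since \<open>Q\<close> preserves
  lengths, its norm is that of the diagonal factor, namely the largest absolute diagonal entry
  (\<open>onorm_orthogonal_diag\<close>).

  The eigenbasis is the substance of the proof (\<open>symmetric_matrix_diagonalizable\<close>). A self-adjoint
  map has an eigenvector in every nonzero invariant subspace: a maximiser of the Rayleigh quotient,
  which exists by compactness of the unit sphere (\<open>self_adjoint_eigenvector_exists\<close>). The vectors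
  orthogonal to a set of eigenvectors form an invariant subspace, so an orthonormal set of
  eigenvectors that is as large as possible leaves nothing orthogonal to it, and is a basis.

  The diagonal entries \<open>m\<^sub>i\<close> so obtained need not come in the order of the given list \<open>\<mu>\<^sub>i\<close>. Both
  are the roots of the characteristic polynomial, so they have the same set of values, and a maximum
  depends on nothing more.
\<close>

section \<open>Eigenvectors of self-adjoint maps\<close>

text \<open>For small \<open>t\<close> the linear term dominates, and its sign can be chosen by that of \<open>t\<close>.\<close>
lemma quadratic_nonneg_imp_linear_coeff_zero:
  fixes b c :: real
  assumes nonneg: "\<And>t. 0 \<le> 2 * t * b + t\<^sup>2 * c" and c: "0 \<le> c"
  shows "b = 0"
proof -
  \<comment> \<open>At \<open>t = - b / c\<close> the quadratic is minimal; \<open>c + 1\<close> in its place allows \<open>c = 0\<close>.\<close>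
  define s where "s = b / (c + 1)"
  have b: "b = s * (c + 1)"
    using c by (simp add: s_def)
  have "0 \<le> 2 * (- s) * b + (- s)\<^sup>2 * c"
    by (rule nonneg)
  also have "\<dots> = - (s\<^sup>2 * (c + 2))"
    by (simp add: b algebra_simps power2_eq_square)
  finally have "s\<^sup>2 * (c + 2) \<le> 0" by simp
  with c show ?thesis
    by (simp add: b mult_le_0_iff)
qed

text \<open>
  Let \<open>v\<close> maximise \<open>x \<bullet> f x\<close> over the unit vectors of the subspace, with maximum \<open>l\<close>. The form
  \<open>l (x \<bullet> x) - x \<bullet> f x\<close> is then nonnegative on the subspace and vanishes at \<open>v\<close>, so \<open>v\<close> is a critical
  point: its derivative there in every direction \<open>w\<close> of the subspace, a multiple of
  \<open>w \<bullet> (l v - f v)\<close>, is zero. By invariance \<open>w = l v - f v\<close> is such a direction.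
\<close>
lemma self_adjoint_eigenvector_exists:
  fixes f :: "'a::euclidean_space \<Rightarrow> 'a"
  assumes lin: "linear f" and self_adjoint: "\<And>x y. f x \<bullet> y = x \<bullet> f y"
    and S: "subspace S" and inv: "\<And>x. x \<in> S \<Longrightarrow> f x \<in> S"
    and nontrivial: "u \<in> S" "u \<noteq> 0"
  obtains v l where "v \<in> S" "norm v = 1" "f v = l *\<^sub>R v"
proof -
  let ?K = "S \<inter> sphere 0 1"
  have "compact ?K"
    using closed_subspace[OF S] by (intro closed_Int_compact) auto
  moreover have "u /\<^sub>R norm u \<in> ?K"
    using nontrivial S by (simp add: subspace_scale)
  moreover have "continuous_on ?K (\<lambda>x. x \<bullet> f x)"
    by (intro continuous_intros linear_continuous_on linear_conv_bounded_linear[THEN iffD1] lin)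
  ultimately obtain v where v: "v \<in> ?K" and max: "\<And>x. x \<in> ?K \<Longrightarrow> x \<bullet> f x \<le> v \<bullet> f v"
    using continuous_attains_sup[of ?K "\<lambda>x. x \<bullet> f x"] by blast
  define l where "l = v \<bullet> f v"
  define w where "w = l *\<^sub>R v - f v"
  have vv: "v \<bullet> v = 1" "v \<in> S" "norm v = 1"
    using v by (auto simp: norm_eq_1)
  have w: "w \<in> S"
    using S inv vv by (simp add: w_def subspace_diff subspace_scale)
  have rayleigh: "x \<bullet> f x \<le> l * (x \<bullet> x)" if "x \<in> S" for x
  proof (cases "x = 0")
    case False
    then have "x /\<^sub>R norm x \<in> ?K"
      using that S by (simp add: subspace_scale)
    from max[OF this] have "(x \<bullet> f x) / (norm x)\<^sup>2 \<le> l"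
      by (simp add: l_def linear_scale[OF lin] power2_eq_square field_simps)
    with False show ?thesis
      by (simp add: power2_norm_eq_inner pos_divide_le_eq)
  qed (simp add: linear_0[OF lin])
  have "0 \<le> 2 * t * (w \<bullet> w) + t\<^sup>2 * (l * (w \<bullet> w) - w \<bullet> f w)" for t
  proof -
    have "v \<bullet> f w = w \<bullet> f v"
      using self_adjoint[of v w] by (simp add: inner_commute)
    then have form: "(v + t *\<^sub>R w) \<bullet> f (v + t *\<^sub>R w) = l + 2 * t * (w \<bullet> f v) + t\<^sup>2 * (w \<bullet> f w)"
      by (simp add: linear_add[OF lin] linear_scale[OF lin] inner_left_distrib inner_right_distrib
          l_def power2_eq_square algebra_simps)
    have square: "(v + t *\<^sub>R w) \<bullet> (v + t *\<^sub>R w) = 1 + 2 * t * (w \<bullet> v) + t\<^sup>2 * (w \<bullet> w)"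
      by (simp add: inner_left_distrib inner_right_distrib vv inner_commute[of v w]
          power2_eq_square algebra_simps)
    have ww: "w \<bullet> w = l * (w \<bullet> v) - w \<bullet> f v"
      by (subst (2) w_def) (simp add: inner_diff_right)
    have "v + t *\<^sub>R w \<in> S"
      using S vv w by (simp add: subspace_add subspace_scale)
    from rayleigh[OF this]
    have "0 \<le> 2 * t * (l * (w \<bullet> v) - w \<bullet> f v) + t\<^sup>2 * (l * (w \<bullet> w) - w \<bullet> f w)"
      unfolding form square by (simp add: algebra_simps)
    then show ?thesis
      by (simp only: ww[symmetric])
  qed
  then have "w \<bullet> w = 0"
    by (rule quadratic_nonneg_imp_linear_coeff_zero) (use rayleigh[OF w] in simp)
  then show thesis
    using vv by (intro that[of v l]) (simp_all add: w_def)
qed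

text \<open>
  Orthonormal sets are independent, so their cardinality is bounded and a largest set \<open>B\<close> of
  orthonormal eigenvectors exists. The orthogonal complement of \<open>B\<close> is invariant because
  \<open>f x \<bullet> v = x \<bullet> f v\<close> is a multiple of \<open>x \<bullet> v = 0\<close> for \<open>v \<in> B\<close>; if it were not trivial it would
  contain a further unit eigenvector, and \<open>B\<close> could be enlarged.
\<close>
theorem self_adjoint_orthonormal_eigenbasis:
  fixes f :: "'a::euclidean_space \<Rightarrow> 'a"
  assumes lin: "linear f" and self_adjoint: "\<And>x y. f x \<bullet> y = x \<bullet> f y"
  obtains B where "pairwise orthogonal B" "\<And>v. v \<in> B \<Longrightarrow> norm v = 1"
    "\<And>v. v \<in> B \<Longrightarrow> \<exists>l. f v = l *\<^sub>R v" "finite B" "card B = DIM('a)"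
proof -
  define orthonormal_eigenset where
    "orthonormal_eigenset B \<longleftrightarrow> pairwise orthogonal B \<and> (\<forall>v\<in>B. norm v = 1 \<and> (\<exists>l. f v = l *\<^sub>R v))" for B
  have bound: "finite B \<and> card B \<le> DIM('a)" if "orthonormal_eigenset B" for B
  proof -
    have "independent B"
      using that by (intro pairwise_orthogonal_independent) (auto simp: orthonormal_eigenset_def)
    then show ?thesis
      by (simp add: independent_bound)
  qed
  have "orthonormal_eigenset {}" by (simp add: orthonormal_eigenset_def pairwise_def)
  moreover have "\<forall>B. orthonormal_eigenset B \<longrightarrow> card B < Suc DIM('a)"
    using bound by (simp add: less_Suc_eq_le)
  ultimately obtain B where B: "orthonormal_eigenset B" and maximal: "\<And>C. orthonormal_eigenset C \<Longrightarrow> card C \<le> card B"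
    using ex_has_greatest_nat[of orthonormal_eigenset "{}" card] by (metis less_imp_le)
  have fin: "finite B" using bound B by simp
  have "card B = DIM('a)"
  proof (rule ccontr)
    assume "card B \<noteq> DIM('a)"
    then have "dim B < DIM('a)"
      using bound[OF B] dim_le_card'[OF fin] by linarith
    then obtain u where u: "u \<noteq> 0" "\<And>y. y \<in> span B \<Longrightarrow> orthogonal u y"
      using orthogonal_to_subspace_exists by blast
    define S where "S = {x. \<forall>v\<in>B. x \<bullet> v = 0}"
    have "subspace S"
      by (auto simp: S_def subspace_def inner_left_distrib)
    moreover have "f x \<in> S" if "x \<in> S" for x
      using that B by (force simp: S_def orthonormal_eigenset_def self_adjoint)
    moreover have "u \<in> S"
      using u(2) by (simp add: S_def orthogonal_def span_base)
    ultimately obtain v l where v: "v \<in> S" "norm v = 1" "f v = l *\<^sub>R v"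
      using self_adjoint_eigenvector_exists[OF lin self_adjoint] u(1) by metis
    have "v \<notin> B"
      using v by (auto simp: S_def)
    moreover have "orthonormal_eigenset (insert v B)"
      using v B by (auto simp: orthonormal_eigenset_def pairwise_insert S_def orthogonal_def inner_commute)
    ultimately show False
      using maximal[of "insert v B"] fin by simp
  qed
  with B fin show thesis
    by (intro that[of B]) (auto simp: orthonormal_eigenset_def)
qed

section \<open>Orthogonal diagonalisation\<close>

text \<open>
  With an orthonormal eigenbasis \<open>q\<close> as the columns of \<open>Q\<close>, the equations \<open>A q\<^sub>j = m\<^sub>j q\<^sub>j\<close> say
  that \<open>A Q = Q diag(m)\<close>.
\<close>
theorem symmetric_matrix_diagonalizable:
  fixes A :: "real^'d^'d"
  assumes sym: "transpose A = A"
  obtains Q m where "orthogonal_matrix Q" "A = Q ** diag_mat m ** transpose Q"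
proof -
  have self_adjoint: "(A *v x) \<bullet> y = x \<bullet> (A *v y)" for x y
    by (metis dot_lmul_matrix sym vector_transpose_matrix)
  obtain B :: "(real^'d) set" where B: "pairwise orthogonal B" "\<And>v. v \<in> B \<Longrightarrow> norm v = 1"
    "\<And>v. v \<in> B \<Longrightarrow> \<exists>l. A *v v = l *\<^sub>R v" "finite B" "card B = CARD('d)"
    using self_adjoint_orthonormal_eigenbasis[OF matrix_vector_mul_linear self_adjoint]
    by (metis DIM_cart DIM_real mult_1_right)
  obtain q :: "'d \<Rightarrow> real^'d" where q: "bij_betw q UNIV B"
    using B(4,5) finite_same_card_bij[of "UNIV :: 'd set" B] by auto
  have qB: "q j \<in> B" for j
    using q by (auto simp: bij_betw_def)
  obtain m where m: "\<And>j. A *v q j = m j *\<^sub>R q j"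
    using B(3)[OF qB] by metis
  define Q :: "real^'d^'d" where "Q = (\<chi> i j. q j $ i)"
  have col: "column j Q = q j" for j
    by (simp add: Q_def column_def vec_eq_iff)
  have "orthogonal (q i) (q j)" if "i \<noteq> j" for i j
    using that q B(1) qB by (auto simp: bij_betw_def pairwise_def dest: injD)
  then have Q: "orthogonal_matrix Q"
    by (simp add: orthogonal_matrix_orthonormal_columns col B(2) qB)
  have "(A ** Q) $ i $ j = (A *v q j) $ i" for i j
    by (simp add: matrix_matrix_mult_def matrix_vector_mult_def Q_def)
  then have "A ** Q = Q ** diag_mat m"
    by (simp add: vec_eq_iff matrix_mult_diag_mat m) (simp add: Q_def)
  then have "A = Q ** diag_mat m ** transpose Q"
    by (metis Q matrix_mul_assoc matrix_mul_rid orthogonal_matrix_def)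
  with Q show thesis by (rule that)
qed

lemma orthogonal_diag_diff:
  fixes Q :: "real^'d^'d"
  shows "Q ** diag_mat m ** transpose Q - Q ** diag_mat n ** transpose Q
    = Q ** diag_mat (\<lambda>i. m i - n i) ** transpose Q"
  by (simp add: vec_eq_iff matrix_matrix_mult_def[of _ "transpose Q"] matrix_mult_diag_mat
      sum_subtractf algebra_simps)

text \<open>
  The characteristic polynomial is invariant under conjugation by \<open>Q\<close>, so it is also the product
  of the factors \<open>x - m i\<close>; a real number belongs to either range iff it is a root.
\<close>
lemma range_eigenvalues_listed_by:
  fixes A :: "real^'d^'d"
  assumes Q: "orthogonal_matrix Q" and A: "A = Q ** diag_mat m ** transpose Q"
    and \<mu>: "eigenvalues_listed_by A \<mu>"
  shows "range \<mu> = range m"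
proof -
  have QQ: "Q ** transpose Q = mat 1"
    using Q by (simp add: orthogonal_matrix_def)
  have same_poly: "(\<Prod>i\<in>UNIV. x - \<mu> i) = (\<Prod>i\<in>UNIV. x - m i)" for x
  proof -
    have "mat x - A = Q ** diag_mat (\<lambda>i. x - m i) ** transpose Q"
    proof -
      have "(Q ** diag_mat (\<lambda>_. x) ** transpose Q) $ i $ j = x * (Q ** transpose Q) $ i $ j" for i j
        by (simp only: matrix_matrix_mult_def[of _ "transpose Q"] matrix_mult_diag_mat
            vec_lambda_beta sum_distrib_left mult_ac)
      then have "mat x = Q ** diag_mat (\<lambda>_. x) ** transpose Q"
        by (simp add: vec_eq_iff QQ mat_def)
      then show ?thesis
        unfolding A by (simp only: orthogonal_diag_diff)
    qed
    then have "det (mat x - A) = det (Q ** transpose Q) * det (diag_mat (\<lambda>i. x - m i))"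
      by (simp add: det_mul)
    also have "\<dots> = (\<Prod>i\<in>UNIV. x - m i)"
      by (simp add: QQ det_diagonal diag_mat_def)
    finally show ?thesis
      using \<mu> by (simp add: eigenvalues_listed_by_def)
  qed
  have roots: "(\<Prod>i\<in>UNIV. x - n i) = 0 \<longleftrightarrow> x \<in> range n" for x and n :: "'d \<Rightarrow> real"
    by (auto simp: image_iff)
  have "x \<in> range \<mu> \<longleftrightarrow> x \<in> range m" for x
    by (simp only: roots[symmetric] same_poly)
  then show ?thesis
    by (rule set_eqI)
qed

section \<open>Spectral norm\<close>

lemma diag_mat_mult_vec: "(diag_mat m *v x) $ i = m i * x $ i"
  by (simp add: matrix_vector_mult_def diag_mat_def if_distrib[where f="\<lambda>y. y * _"] cong: if_cong)

lemma norm_orthogonal_matrix_mult: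
  fixes Q :: "real^'d^'d"
  assumes "orthogonal_matrix Q"
  shows "norm (Q *v x) = norm x"
  using assms orthogonal_transformation_matrix[of "(*v) Q"]
  by (simp add: orthogonal_transformation)

text \<open>
  Multiplying by \<open>Q\<close> or its transpose changes no length, and \<open>diag(m)\<close> scales each coordinate by at
  most the largest \<open>\<bar>m i\<bar>\<close>. The bound is attained at a column of \<open>Q\<close>.
\<close>
lemma onorm_orthogonal_diag:
  fixes Q :: "real^'d^'d"
  assumes Q: "orthogonal_matrix Q"
  shows "onorm ((*v) (Q ** diag_mat m ** transpose Q)) = (MAX i\<in>UNIV. \<bar>m i\<bar>)"
proof -
  define M where "M = (MAX i\<in>UNIV. \<bar>m i\<bar>)"
  let ?T = "Q ** diag_mat m ** transpose Q"
  have le_M: "\<bar>m i\<bar> \<le> M" for i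
    unfolding M_def by (intro Max_ge) auto
  have M: "0 \<le> M"
    using le_M[of undefined] by linarith
  have T: "norm (?T *v x) = norm (diag_mat m *v (transpose Q *v x))" for x
    by (metis norm_orthogonal_matrix_mult[OF Q] matrix_vector_mul_assoc)
  have upper: "onorm ((*v) ?T) \<le> M"
  proof (rule onorm_le)
    fix x
    have "norm ((diag_mat m *v y) $ i) \<le> norm ((M *\<^sub>R y) $ i)" for y i
      using mult_right_mono[OF le_M[of i] abs_ge_zero[of "y $ i"]] M
      by (simp add: diag_mat_mult_vec abs_mult)
    then have "norm (?T *v x) \<le> norm (M *\<^sub>R (transpose Q *v x))"
      unfolding T by (rule norm_le_componentwise_cart)
    then show "norm (?T *v x) \<le> M * norm x"
      using M norm_orthogonal_matrix_mult[of "transpose Q" x] Q by simp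
  qed
  have "\<bar>m i\<bar> \<le> onorm ((*v) ?T)" for i
  proof -
    \<comment> \<open>The \<open>i\<close>-th column of \<open>Q\<close> is a unit eigenvector for \<open>m i\<close>.\<close>
    let ?x = "Q *v axis i 1"
    have "transpose Q *v ?x = axis i 1"
      using Q by (simp add: matrix_vector_mul_assoc orthogonal_matrix_def)
    moreover have "diag_mat m *v axis i 1 = m i *\<^sub>R axis i 1"
      by (simp add: vec_eq_iff diag_mat_mult_vec axis_def)
    ultimately have "norm (?T *v ?x) = \<bar>m i\<bar>"
      by (simp add: T)
    moreover have "norm ?x = 1"
      using Q by (simp add: norm_orthogonal_matrix_mult)
    ultimately show ?thesis
      using onorm[OF matrix_vector_mul_bounded_linear, of ?T ?x] by simp
  qed
  then have "M \<le> onorm ((*v) ?T)"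
    by (simp add: M_def)
  with upper show ?thesis
    unfolding M_def by (rule antisym)
qed

theorem proposition3p2:
  fixes A R R' :: "real^'d^'d" and \<mu> :: "'d \<Rightarrow> real" and \<phi> :: "real \<Rightarrow> real"
  assumes "transpose A = A"
    and "eigenvalues_listed_by A \<mu>"
    and "R = matrix_fun sgn A"
    and "R' = matrix_fun \<phi> A"
  shows "onorm (\<lambda>x. (R' - R) *v x) = (MAX i\<in>UNIV. \<bar>\<phi> (\<mu> i) - sgn (\<mu> i)\<bar>)"
proof -
  obtain Q m where Q: "orthogonal_matrix Q" and A: "A = Q ** diag_mat m ** transpose Q"
    using symmetric_matrix_diagonalizable[OF assms(1)] .
  define g where "g z = \<bar>\<phi> z - sgn z\<bar>" for z
  have "R' - R = Q ** diag_mat (\<lambda>i. \<phi> (m i) - sgn (m i)) ** transpose Q"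
    unfolding assms(3,4) matrix_fun_eq[OF Q A] by (rule orthogonal_diag_diff)
  then have "onorm (\<lambda>x. (R' - R) *v x) = Max (g ` range m)"
    by (simp add: onorm_orthogonal_diag[OF Q] g_def image_image)
  also have "range m = range \<mu>"
    using range_eigenvalues_listed_by[OF Q A assms(2)] by simp
  finally show ?thesis
    by (simp add: g_def image_image)
qed

end
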